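(* Let $r\ge2$, $2^{r-1}\le n\le2^r-1$, let $u$ be either the Cartesian kernel (C) or the spherical kernel (S), and let $f,g:\mathbf R^n\to\mathcal A_r$ be originals whose images $F^n_u(p;\zeta)$ and $G^n_u(p;\zeta)$ exist in the domains $W_f$ and $W_g$ respectively. Suppose that one of the following holds: (i) $r=2$ (so $\mathcal A_2=\mathbf H$) and $\alpha,\beta\in\mathcal A_2$; (ii) $r\ge3$, $f$ and $g$ are real-valued, and $\alpha,\beta\in\mathcal A_r$; (iii) $r\ge3$, $f$ and $g$ are $\mathcal A_r$-valued, and $\alpha,\beta\in\mathbf R$. Then $\alpha F^n_u(p;\zeta)+\beta G^n_u(p;\zeta)$ is the image of the function $\alpha f(t)+\beta g(t)$ in the domain $W_f\cap W_g$.
   Context: Cayley–Dickson algebras: $\mathcal A_0=\mathbf R$ and $\mathcal A_{r+1}=\mathcal A_r\oplus\mathcal A_r\mathbf l$ with $(\xi+\eta\mathbf l)(\gamma+\delta\mathbf l)=(\xi\gamma-\delta^*\eta)+(\delta\xi+\eta\gamma^* )\mathbf l$, $(\xi+\eta\mathbf l)^*=\xi^*-\eta\mathbf l$. The standard basis of $\mathcal A_r$ is $i_0=1,i_1,\dots,i_{2^r-1}$, with $i_j^2=-1$, $i_ji_k=-i_ki_j$ for $j\ne k$, $j,k\ge1$ (any family of generators obtained from it by an automorphism of $\mathcal A_r$ may be used instead). $\mathrm{Re}(z)=(z+z^* )/2$, $|z|^2=zz^*$, $\exp(z)=\sum_kz^k/k!$. Write $p=\sum_jp_ji_j$, $\zeta=\sum_j\zeta_ji_j$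 with real $p_j,\zeta_j$. When $n<2^r-1$ one puts $p_m=\zeta_m=t_m=0$ for $m>n$. Originals: $f:\mathbf R^n\to\mathcal A_r$ is an original if (1) $f$ is continuous almost everywhere for the Lebesgue measure; (2) each partial function $t_j\mapsto f(t)$ has on each finite interval only finitely many discontinuities, all of the first kind; (3) each partial function $g_j(t_j)=f(t)$ satisfies, except possibly at its discontinuities of the first kind, a Hölder condition $|g_j(t_j+h)-g_j(t_j)|\le A_j|h|^{\alpha_j}$ for $|h|<\delta_j$, with constants $0<\alpha_j\le1$, $A_j,\delta_j>0$ (for the given $t$); (4) there are real $a_1(f),a_{-1}(f)$ and constants $C_v>0$ such that for each $v\in\{-1,1\}^n$, $|f(t)|<C_v\exp(\sum_ja_{v_j}t_j)$ whenever $v_jt_j\ge0$ for all $j$. $W_f=\{p\in\mathcal A_r:a_1(f)<\mathrm{Re}(p)<a_{-1}(f)\}$. Kernels: (C) Cartesian: $u(p,t;\zeta)=p_0(t_1+\dots+t_n)+\sum_{j=1}^np_jt_ji_j+\zeta$. (S) Spherical: with $s_j=t_j+\dots+t_n$, $K=2^r-1$, $\phi_j=p_js_j+\zeta_j$: $u=p_0s_1+M+\zeta_0$, $M=\phi_1[i_1\cos\phi_2+i_2\sin\phi_2\cos\phi_3+\dots+i_{K-1}\sin\phi_2\cdots\sin\phi_{K-1}\cos\phi_K+i_K\sin\phi_2\cdots\sin\phi_K]$. Image: $F^n_u(p;\zeta)=\int_{\mathbf R^n}f(t)\exp(-u(p,t;\zeta))\,dt$. *)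

theory Defs
  imports "HOL-Analysis.Analysis" "HOL-Library.Word"
begin

section \<open>Cayley-Dickson algebras\<close>

text \<open>The doubling recursion is carried out on coordinate sequences: at level \<open>r\<close> only the
  entries with index below \<open>2^r\<close> are meaningful.  At level \<open>Suc r\<close> the sequence \<open>x\<close>
  stands for \<open>\<xi> + \<eta> l\<close>, where \<open>\<xi>\<close> consists of the entries of \<open>x\<close> below \<open>2^r\<close> and
  \<open>\<eta> = cds_hi r x\<close>; hence \<open>i_(2^r + k) = i_k l\<close>.\<close>

definition cds_hi :: "nat \<Rightarrow> (nat \<Rightarrow> real) \<Rightarrow> nat \<Rightarrow> real" where
  "cds_hi r x = (\<lambda>k. x (2 ^ r + k))"

definition cds_join :: "nat \<Rightarrow> (nat \<Rightarrow> real) \<Rightarrow> (nat \<Rightarrow> real) \<Rightarrow> nat \<Rightarrow> real" where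
  "cds_join r a b = (\<lambda>k. if k < 2 ^ r then a k else b (k - 2 ^ r))"

primrec cds_cnj :: "nat \<Rightarrow> (nat \<Rightarrow> real) \<Rightarrow> nat \<Rightarrow> real" where
  "cds_cnj 0 x = x"
| "cds_cnj (Suc r) x = cds_join r (cds_cnj r x) (\<lambda>k. - cds_hi r x k)"

primrec cds_times :: "nat \<Rightarrow> (nat \<Rightarrow> real) \<Rightarrow> (nat \<Rightarrow> real) \<Rightarrow> nat \<Rightarrow> real" where
  "cds_times 0 x y = (\<lambda>k. x 0 * y 0)"
| "cds_times (Suc r) x y =
     cds_join r
       (\<lambda>k. cds_times r x y k - cds_times r (cds_cnj r (cds_hi r y)) (cds_hi r x) k)
       (\<lambda>k. cds_times r (cds_hi r y) x k + cds_times r (cds_hi r x) (cds_cnj r y) k)"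

text \<open>The algebra of level \<open>r = LENGTH('r)\<close> is the Euclidean space of dimension \<open>2^r\<close> whose
  coordinates are indexed by the \<open>r\<close>-bit words, that is, by the numbers \<open>0, \<dots>, 2^r - 1\<close>.\<close>

type_synonym 'r cd = "(real, 'r word) vec"

definition cd_seq :: "'r::len cd \<Rightarrow> nat \<Rightarrow> real" where
  "cd_seq x = (\<lambda>k. x $ of_nat k)"

definition cd_of_seq :: "(nat \<Rightarrow> real) \<Rightarrow> 'r::len cd" where
  "cd_of_seq c = (\<chi> w. c (unat w))"

definition cd_basis :: "nat \<Rightarrow> 'r::len cd" where
  "cd_basis j = axis (of_nat j) 1"

abbreviation cd_one :: "'r::len cd" where
  "cd_one \<equiv> cd_basis 0"

definition cd_cnj :: "'r::len cd \<Rightarrow> 'r cd" where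
  "cd_cnj x = cd_of_seq (cds_cnj LENGTH('r) (cd_seq x))"

definition cd_times :: "'r::len cd \<Rightarrow> 'r cd \<Rightarrow> 'r cd"  (infixl \<open>\<odot>\<close> 70) where
  "x \<odot> y = cd_of_seq (cds_times LENGTH('r) (cd_seq x) (cd_seq y))"

text \<open>\<open>(z + cnj z) / 2\<close> and \<open>z cnj z\<close> are real multiples of \<open>1\<close>; the real number is
  read off as the coordinate of index \<open>0\<close>.\<close>

definition cd_Re :: "'r::len cd \<Rightarrow> real" where
  "cd_Re z = ((1 / 2) *\<^sub>R (z + cd_cnj z)) $ 0"

definition cd_abs :: "'r::len cd \<Rightarrow> real" where
  "cd_abs z = sqrt ((z \<odot> cd_cnj z) $ 0)"

definition cd_reals :: "'r::len cd set" where
  "cd_reals = range (\<lambda>c::real. c *\<^sub>R cd_one)"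

primrec cd_power :: "'r::len cd \<Rightarrow> nat \<Rightarrow> 'r cd" where
  "cd_power z 0 = cd_one"
| "cd_power z (Suc k) = z \<odot> cd_power z k"

definition cd_exp :: "'r::len cd \<Rightarrow> 'r cd" where
  "cd_exp z = (\<Sum>k. (1 / fact k) *\<^sub>R cd_power z k)"

definition cd_automorphism :: "('r::len cd \<Rightarrow> 'r cd) \<Rightarrow> bool" where
  "cd_automorphism \<theta> \<longleftrightarrow> linear \<theta> \<and> bij \<theta> \<and> (\<forall>x y. \<theta> (x \<odot> y) = \<theta> x \<odot> \<theta> y)"

definition cd_generators :: "(nat \<Rightarrow> 'r::len cd) \<Rightarrow> bool" where
  "cd_generators e \<longleftrightarrow>
     (\<exists>\<theta>. cd_automorphism \<theta> \<and> (\<forall>j < 2 ^ LENGTH('r). e j = \<theta> (cd_basis j)))"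

definition cd_coord :: "(nat \<Rightarrow> 'r::len cd) \<Rightarrow> 'r cd \<Rightarrow> nat \<Rightarrow> real" where
  "cd_coord e z j = representation (e ` {..<2 ^ LENGTH('r)}) z (e j)"

text \<open>The elements that are allowed as values of \<open>p\<close> and \<open>\<zeta>\<close> for functions of \<open>n\<close>
  real variables: the coordinates with index \<open>m > n\<close> vanish.\<close>

definition cd_supp :: "(nat \<Rightarrow> 'r::len cd) \<Rightarrow> nat \<Rightarrow> 'r cd set" where
  "cd_supp e n = {z. \<forall>m. n < m \<and> m < 2 ^ LENGTH('r) \<longrightarrow> cd_coord e z m = 0}"


section \<open>Originals\<close>

text \<open>Points of \<open>\<real>\<^sup>n\<close> are families \<open>t\<close> on \<open>{1..n}\<close>.  Lebesgue measure is the completion of the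
  product measure, since a function that is continuous almost everywhere need not be
  Borel measurable.\<close>

definition Rn :: "nat \<Rightarrow> (nat \<Rightarrow> real) set" where
  "Rn n = {1..n} \<rightarrow>\<^sub>E UNIV"

definition leb :: "nat \<Rightarrow> (nat \<Rightarrow> real) measure" where
  "leb n = completion (\<Pi>\<^sub>M j\<in>{1..n}. lborel)"

definition first_kind :: "(real \<Rightarrow> 'a::topological_space) \<Rightarrow> real \<Rightarrow> bool" where
  "first_kind g x \<longleftrightarrow> \<not> isCont g x \<and>
     (\<exists>l. (g \<longlongrightarrow> l) (at_left x)) \<and> (\<exists>l. (g \<longlongrightarrow> l) (at_right x))"

text \<open>\<open>a1\<close> and \<open>am1\<close> are the growth constants for the signs \<open>1\<close> and \<open>-1\<close>.\<close>

definition cd_original ::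
    "nat \<Rightarrow> ((nat \<Rightarrow> real) \<Rightarrow> 'r::len cd) \<Rightarrow> real \<Rightarrow> real \<Rightarrow> bool" where
  "cd_original n f a1 am1 \<longleftrightarrow>
     (AE t in leb n. continuous (at t within Rn n) f) \<and>
     (\<forall>t\<in>Rn n. \<forall>j\<in>{1..n}. let g = (\<lambda>x. f (t(j := x))) in
        (\<forall>a b. finite {x\<in>{a..b}. \<not> isCont g x}) \<and>
        (\<forall>x. \<not> isCont g x \<longrightarrow> first_kind g x)) \<and>
     (\<forall>t\<in>Rn n. \<forall>j\<in>{1..n}. let g = (\<lambda>x. f (t(j := x))) in
        \<not> first_kind g (t j) \<longrightarrow>
        (\<exists>\<alpha> A \<delta>. 0 < \<alpha> \<and> \<alpha> \<le> 1 \<and> 0 < A \<and> 0 < \<delta> \<and>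
           (\<forall>h. \<bar>h\<bar> < \<delta> \<longrightarrow> cd_abs (g (t j + h) - g (t j)) \<le> A * \<bar>h\<bar> powr \<alpha>))) \<and>
     (\<forall>v\<in>{1..n} \<rightarrow>\<^sub>E {-1, 1::real}. \<exists>C>0. \<forall>t\<in>Rn n.
        (\<forall>j\<in>{1..n}. 0 \<le> v j * t j) \<longrightarrow>
        cd_abs (f t) < C * exp (\<Sum>j=1..n. (if v j = 1 then a1 else am1) * t j))"

definition cd_domain :: "real \<Rightarrow> real \<Rightarrow> 'r::len cd set" where
  "cd_domain a1 am1 = {p. a1 < cd_Re p \<and> cd_Re p < am1}"


section \<open>Kernels and images\<close>

type_synonym 'r kernel = "'r cd \<Rightarrow> (nat \<Rightarrow> real) \<Rightarrow> 'r cd \<Rightarrow> 'r cd"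

definition cartesian_kernel :: "(nat \<Rightarrow> 'r::len cd) \<Rightarrow> nat \<Rightarrow> 'r kernel" where
  "cartesian_kernel e n p t \<zeta> =
     (cd_coord e p 0 * (\<Sum>j=1..n. t j)) *\<^sub>R cd_one
     + (\<Sum>j=1..n. (cd_coord e p j * t j) *\<^sub>R e j) + \<zeta>"

text \<open>For \<open>j > n\<close> the sum defining \<open>s\<^sub>j\<close> is empty.\<close>

definition spherical_angle ::
    "(nat \<Rightarrow> 'r::len cd) \<Rightarrow> nat \<Rightarrow> 'r cd \<Rightarrow> (nat \<Rightarrow> real) \<Rightarrow> 'r cd \<Rightarrow> nat \<Rightarrow> real" where
  "spherical_angle e n p t \<zeta> j = cd_coord e p j * (\<Sum>k=j..n. t k) + cd_coord e \<zeta> j"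

definition spherical_kernel :: "(nat \<Rightarrow> 'r::len cd) \<Rightarrow> nat \<Rightarrow> 'r kernel" where
  "spherical_kernel e n p t \<zeta> =
     (let K = 2 ^ LENGTH('r) - 1; \<phi> = spherical_angle e n p t \<zeta> in
        (cd_coord e p 0 * (\<Sum>k=1..n. t k)) *\<^sub>R cd_one
        + \<phi> 1 *\<^sub>R ((\<Sum>j=1..K-1. ((\<Prod>m=2..j. sin (\<phi> m)) * cos (\<phi> (j + 1))) *\<^sub>R e j)
                   + (\<Prod>m=2..K. sin (\<phi> m)) *\<^sub>R e K)
        + cd_coord e \<zeta> 0 *\<^sub>R cd_one)"

definition cd_image_exists ::
    "'r::len kernel \<Rightarrow> nat \<Rightarrow> ((nat \<Rightarrow> real) \<Rightarrow> 'r cd) \<Rightarrow> 'r cd \<Rightarrow> 'r cd \<Rightarrow> bool" where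
  "cd_image_exists u n f p \<zeta> \<longleftrightarrow> integrable (leb n) (\<lambda>t. f t \<odot> cd_exp (- u p t \<zeta>))"

definition cd_image ::
    "'r::len kernel \<Rightarrow> nat \<Rightarrow> ((nat \<Rightarrow> real) \<Rightarrow> 'r cd) \<Rightarrow> 'r cd \<Rightarrow> 'r cd \<Rightarrow> 'r cd" where
  "cd_image u n f p \<zeta> = (\<integral>t. f t \<odot> cd_exp (- u p t \<zeta>) \<partial>leb n)"

end

theory Submission
  imports Defs
begin

text \<open>In all three cases \<open>(\<alpha> f + \<beta> g) E = \<alpha> (f E) + \<beta> (g E)\<close> holds pointwise, where \<open>E\<close> is the
  exponential factor: for \<open>r = 2\<close> by associativity of the quaternions, otherwise because
  one of the first two factors of each product is real and hence in the nucleus of the algebra.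
  Left multiplication is a bounded linear map, so it commutes with the integral.\<close>

lemma cds_hi_lincomb:
  "cds_hi r (\<lambda>k. c * x k + d * y k) = (\<lambda>k. c * cds_hi r x k + d * cds_hi r y k)"
  by (simp add: cds_hi_def)

lemma cds_cnj_lincomb:
  "cds_cnj r (\<lambda>k. c * x k + d * y k) = (\<lambda>k. c * cds_cnj r x k + d * cds_cnj r y k)"
  by (induction r) (auto simp: cds_join_def cds_hi_lincomb fun_eq_iff)

text \<open>The two sides need a simultaneous induction: the doubling formula contains
  \<open>\<delta> \<xi>\<close> and \<open>\<delta>* \<eta>\<close>, where a part of the right
  factor stands on the left.\<close>

lemma cds_times_lincomb_left:
  "cds_times r (\<lambda>k. c * x k + d * y k) z = (\<lambda>k. c * cds_times r x z k + d * cds_times r y z k)"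
  and cds_times_lincomb_right:
  "cds_times r z (\<lambda>k. c * x k + d * y k) = (\<lambda>k. c * cds_times r z x k + d * cds_times r z y k)"
proof (induction r arbitrary: x y z)
  case 0
  { case 1 show ?case by (simp add: algebra_simps) }
  { case 2 show ?case by (simp add: algebra_simps) }
next
  case (Suc r)
  { case 1 show ?case
      by (auto simp: cds_join_def cds_hi_lincomb cds_cnj_lincomb Suc.IH fun_eq_iff algebra_simps) }
  { case 2 show ?case
      by (auto simp: cds_join_def cds_hi_lincomb cds_cnj_lincomb Suc.IH fun_eq_iff algebra_simps) }
qed

lemma cds_cnj_eq_0:
  assumes "\<And>k. k < 2 ^ r \<Longrightarrow> x k = 0" "k < 2 ^ r"
  shows "cds_cnj r x k = 0"
  using assms by (induction r arbitrary: x k) (auto simp: cds_join_def cds_hi_def)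

text \<open>Bilinearity alone does not suffice: \<open>x\<close> is zero only below
  \<open>2 ^ r\<close>, and its later entries are arbitrary, because the recursion passes
  \<open>\<xi>\<close> on as the whole, untruncated sequence. Again the swapped factors force a
  joint induction.\<close>

lemma
  assumes "\<And>k. k < 2 ^ r \<Longrightarrow> x k = 0" "k < 2 ^ r"
  shows cds_times_zero_left: "cds_times r x y k = 0"
    and cds_times_zero_right: "cds_times r y x k = 0"
  using assms
proof (induction r arbitrary: x y k)
  case 0
  { case 1 then show ?case by simp }
  { case 2 then show ?case by simp }
next
  case (Suc r)
  { case 1
    have "cds_hi r x j = 0" "x j = 0" if "j < 2 ^ r" for j
      using 1(1) that by (simp_all add: cds_hi_def)
    then show ?case
      using 1(2) by (simp add: cds_join_def Suc.IH) }
  { case 2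
    have "cds_hi r x j = 0" "x j = 0" if "j < 2 ^ r" for j
      using 2(1) that by (simp_all add: cds_hi_def)
    then show ?case
      using 2(2) by (simp add: cds_join_def Suc.IH cds_cnj_eq_0) }
qed

lemma cds_cnj_unit:
  assumes "\<And>k. k < 2 ^ r \<Longrightarrow> x k = of_bool (k = 0)" "k < 2 ^ r"
  shows "cds_cnj r x k = of_bool (k = 0)"
  using assms by (induction r arbitrary: x k) (auto simp: cds_join_def cds_hi_def)

text \<open>At the next level \<open>\<xi>\<close> is again a unit and \<open>\<eta>\<close>
  vanishes, so \<open>(\<xi> + \<eta> l)(\<gamma> + \<delta> l)\<close> reduces to
  \<open>\<gamma> + \<delta> l\<close>. The mirrored product also needs that conjugation fixes the
  unit.\<close>

lemma
  assumes "\<And>k. k < 2 ^ r \<Longrightarrow> x k = of_bool (k = 0)" "k < 2 ^ r"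
  shows cds_times_unit_left: "cds_times r x y k = y k"
    and cds_times_unit_right: "cds_times r y x k = y k"
  using assms
proof (induction r arbitrary: x y k)
  case 0
  { case 1 then show ?case by simp }
  { case 2 then show ?case by simp }
next
  case (Suc r)
  { case 1
    have "cds_hi r x j = 0" "x j = of_bool (j = 0)" if "j < 2 ^ r" for j
      using 1(1) that by (simp_all add: cds_hi_def)
    then show ?case
      using 1(2)
      by (auto simp add: cds_join_def Suc.IH cds_times_zero_left cds_times_zero_right cds_hi_def) }
  { case 2
    have "cds_hi r x j = 0" "x j = of_bool (j = 0)" if "j < 2 ^ r" for j
      using 2(1) that by (simp_all add: cds_hi_def)
    then show ?case
      using 2(2)
      by (auto simp add: cds_join_def Suc.IH cds_times_zero_left cds_cnj_eq_0 cds_cnj_unit cds_hi_def) }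
qed

lemma unat_less_cd_dim: "unat (w :: 'r::len word) < 2 ^ LENGTH('r)"
  by simp

text \<open>The bound on \<open>k\<close> matters because \<open>of_nat\<close> into words wraps
  around modulo \<open>2 ^ LENGTH('r)\<close>.\<close>

lemma cd_seq_of_seq:
  assumes "k < 2 ^ LENGTH('r)"
  shows "cd_seq (cd_of_seq c :: 'r::len cd) k = c k"
  using assms by (simp add: cd_seq_def cd_of_seq_def unsigned_of_nat take_bit_nat_eq_self)

lemma cd_seq_lincomb:
  "cd_seq (c *\<^sub>R x + d *\<^sub>R y) = (\<lambda>k. c * cd_seq x k + d * cd_seq y k)"
  by (simp add: cd_seq_def)

lemma cd_seq_one:
  assumes "k < 2 ^ LENGTH('r)"
  shows "cd_seq (cd_one :: 'r::len cd) k = of_bool (k = 0)"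
  using assms by (auto simp: cd_seq_def cd_basis_def axis_def word_of_nat_eq_0_iff dest: nat_dvd_not_less intro: gr0I)

lemma cd_times_one_left [simp]: "cd_one \<odot> x = x"
  by (simp add: cd_times_def cd_of_seq_def vec_eq_iff cds_times_unit_left cd_seq_one
      unat_less_cd_dim) (simp add: cd_seq_def)

lemma cd_times_one_right [simp]: "x \<odot> cd_one = x"
  by (simp add: cd_times_def cd_of_seq_def vec_eq_iff cds_times_unit_right cd_seq_one
      unat_less_cd_dim) (simp add: cd_seq_def)

text \<open>In finite dimension every bilinear map is bounded. Boundedness is what lets
  multiplication by a constant pass through the Bochner integral.\<close>

lemma bounded_bilinear_cd_times: "bounded_bilinear ((\<odot>) :: 'r::len cd \<Rightarrow> 'r cd \<Rightarrow> 'r cd)"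
proof -
  have left: "(c *\<^sub>R x + d *\<^sub>R y) \<odot> z = c *\<^sub>R (x \<odot> z) + d *\<^sub>R (y \<odot> z)"
    and right: "z \<odot> (c *\<^sub>R x + d *\<^sub>R y) = c *\<^sub>R (z \<odot> x) + d *\<^sub>R (z \<odot> y)"
    for c d and x y z :: "'r cd"
    by (simp_all add: cd_times_def cd_seq_lincomb cds_times_lincomb_left cds_times_lincomb_right
        cd_of_seq_def vec_eq_iff)
  have "bilinear ((\<odot>) :: 'r cd \<Rightarrow> 'r cd \<Rightarrow> 'r cd)"
    unfolding bilinear_def
  proof (intro conjI allI linearI)
    fix x y z :: "'r cd" and c :: real
    show "x \<odot> (y + z) = x \<odot> y + x \<odot> z" "(x + y) \<odot> z = x \<odot> z + y \<odot> z"
      using left[of 1 x 1 y z] right[of x 1 y 1 z] by simp_all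
    show "x \<odot> (c *\<^sub>R y) = c *\<^sub>R (x \<odot> y)" "(c *\<^sub>R x) \<odot> y = c *\<^sub>R (x \<odot> y)"
      using left[of c x 0 0 y] right[of x c y 0 0] by simp_all
  qed
  then show ?thesis
    by (simp add: bilinear_conv_bounded_bilinear)
qed

interpretation cd_times: bounded_bilinear "(\<odot>) :: 'r::len cd \<Rightarrow> 'r cd \<Rightarrow> 'r cd"
  by (rule bounded_bilinear_cd_times)

text \<open>Doubling the reals twice gives Hamilton's table with \<open>i_1 i_2 = i_3\<close>. Index
  1 is written \<open>Suc 0\<close>, its simp normal form, so that the equations work as rewrite
  rules.\<close>

lemma cds_times_quaternion:
  "cds_times 2 x y 0 = x 0 * y 0 - x (Suc 0) * y (Suc 0) - x 2 * y 2 - x 3 * y 3"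
  "cds_times 2 x y (Suc 0) = x 0 * y (Suc 0) + x (Suc 0) * y 0 + x 2 * y 3 - x 3 * y 2"
  "cds_times 2 x y 2 = x 0 * y 2 - x (Suc 0) * y 3 + x 2 * y 0 + x 3 * y (Suc 0)"
  "cds_times 2 x y 3 = x 0 * y 3 + x (Suc 0) * y 2 - x 2 * y (Suc 0) + x 3 * y 0"
  by (simp_all add: numeral_2_eq_2 numeral_3_eq_3 cds_join_def cds_hi_def algebra_simps)

text \<open>In each of the four coordinates, associativity is a polynomial identity in the
  coordinates of the factors.\<close>

lemma cd_times_assoc_quaternion:
  fixes x y z :: "'r::len cd"
  assumes r: "LENGTH('r) = 2"
  shows "(x \<odot> y) \<odot> z = x \<odot> (y \<odot> z)"
proof -
  have seq: "cd_seq (x \<odot> y) k = cds_times 2 (cd_seq x) (cd_seq y) k" if "k < 4"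
    for x y :: "'r cd" and k
    using that r by (simp add: cd_times_def cd_seq_of_seq)
  have "cd_seq ((x \<odot> y) \<odot> z) k = cd_seq (x \<odot> (y \<odot> z)) k" if k: "k < 4" for k
  proof -
    consider "k = 0" | "k = 1" | "k = 2" | "k = 3"
      using k by linarith
    then show ?thesis
      by cases (simp_all add: seq cds_times_quaternion algebra_simps)
  qed
  \<comment> \<open>Every word \<open>w\<close> is the image of \<open>unat w\<close>, which is
    below 4, so all coordinates are covered.\<close>
  then have "cd_seq ((x \<odot> y) \<odot> z) (unat w) = cd_seq (x \<odot> (y \<odot> z)) (unat w)" for w :: "'r word"
    using unat_less_cd_dim[of w] r by simp
  then show ?thesis
    by (simp add: cd_seq_def vec_eq_iff)
qed

text \<open>Bilinearity pulls the real scalar out of both bracketings, and the unit laws remove the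
  remaining \<open>cd_one\<close>.\<close>

lemma cd_times_assoc_real:
  assumes "x \<in> cd_reals \<or> y \<in> cd_reals"
  shows "(x \<odot> y) \<odot> z = x \<odot> (y \<odot> z)"
  using assms by (auto simp: cd_reals_def cd_times.scaleR_left cd_times.scaleR_right)

lemma
  assumes f: "cd_image_exists u n f p \<zeta>" and g: "cd_image_exists u n g p \<zeta>"
    and assoc: "\<And>t z. t \<in> Rn n \<Longrightarrow> (\<alpha> \<odot> f t) \<odot> z = \<alpha> \<odot> (f t \<odot> z)"
      "\<And>t z. t \<in> Rn n \<Longrightarrow> (\<beta> \<odot> g t) \<odot> z = \<beta> \<odot> (g t \<odot> z)"
  shows cd_image_exists_lincomb: "cd_image_exists u n (\<lambda>t. \<alpha> \<odot> f t + \<beta> \<odot> g t) p \<zeta>"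
    and cd_image_lincomb: "cd_image u n (\<lambda>t. \<alpha> \<odot> f t + \<beta> \<odot> g t) p \<zeta>
      = \<alpha> \<odot> cd_image u n f p \<zeta> + \<beta> \<odot> cd_image u n g p \<zeta>"
proof -
  let ?E = "\<lambda>t. cd_exp (- u p t \<zeta>)"
  have int: "integrable (leb n) (\<lambda>t. f t \<odot> ?E t)" "integrable (leb n) (\<lambda>t. g t \<odot> ?E t)"
    using f g by (simp_all add: cd_image_exists_def)
  have int': "integrable (leb n) (\<lambda>t. \<alpha> \<odot> (f t \<odot> ?E t))"
    "integrable (leb n) (\<lambda>t. \<beta> \<odot> (g t \<odot> ?E t))"
    \<comment> \<open>Linearity in the right argument is linearity of left multiplication by a
      constant.\<close>
    by (intro integrable_bounded_linear[OF cd_times.bounded_linear_right] int)+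
  \<comment> \<open>Completion keeps the underlying space, so associativity on \<open>Rn n\<close>
    is all that the integrals require.\<close>
  have "space (leb n) = Rn n"
    by (simp add: leb_def Rn_def space_PiM)
  then have eq: "(\<alpha> \<odot> f t + \<beta> \<odot> g t) \<odot> ?E t = \<alpha> \<odot> (f t \<odot> ?E t) + \<beta> \<odot> (g t \<odot> ?E t)"
    if "t \<in> space (leb n)" for t
    using that by (simp add: cd_times.add_left assoc)
  show "cd_image_exists u n (\<lambda>t. \<alpha> \<odot> f t + \<beta> \<odot> g t) p \<zeta>"
    unfolding cd_image_exists_def
    using int' by (subst Bochner_Integration.integrable_cong[OF refl eq]) auto
  have "cd_image u n (\<lambda>t. \<alpha> \<odot> f t + \<beta> \<odot> g t) p \<zeta>
      = (\<integral>t. \<alpha> \<odot> (f t \<odot> ?E t) + \<beta> \<odot> (g t \<odot> ?E t) \<partial>leb n)"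
    unfolding cd_image_def by (rule Bochner_Integration.integral_cong[OF refl eq])
  also have "\<dots> = (\<integral>t. \<alpha> \<odot> (f t \<odot> ?E t) \<partial>leb n) + (\<integral>t. \<beta> \<odot> (g t \<odot> ?E t) \<partial>leb n)"
    by (rule Bochner_Integration.integral_add[OF int'])
  also have "\<dots> = \<alpha> \<odot> cd_image u n f p \<zeta> + \<beta> \<odot> cd_image u n g p \<zeta>"
    unfolding cd_image_def
    by (simp add: integral_bounded_linear[OF cd_times.bounded_linear_right] int)
  finally show "cd_image u n (\<lambda>t. \<alpha> \<odot> f t + \<beta> \<odot> g t) p \<zeta>
      = \<alpha> \<odot> cd_image u n f p \<zeta> + \<beta> \<odot> cd_image u n g p \<zeta>" .
qed

theorem proposition10:
  fixes r n :: nat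
    and e :: "nat \<Rightarrow> 'r::len cd"
    and u :: "'r kernel"
    and f g :: "(nat \<Rightarrow> real) \<Rightarrow> 'r cd"
    and a1 am1 b1 bm1 :: real
    and \<alpha> \<beta> \<zeta> :: "'r cd"
  assumes r: "LENGTH('r) = r" "2 \<le> r"
    and n: "2 ^ (r - 1) \<le> n" "n \<le> 2 ^ r - 1"
    and generators: "cd_generators e"
    and kernel: "u = cartesian_kernel e n \<or> u = spherical_kernel e n"
    and original_f: "cd_original n f a1 am1"
    and original_g: "cd_original n g b1 bm1"
    and \<zeta>: "\<zeta> \<in> cd_supp e n"
    and image_f: "\<And>p. p \<in> cd_domain a1 am1 \<inter> cd_supp e n \<Longrightarrow> cd_image_exists u n f p \<zeta>"
    and image_g: "\<And>p. p \<in> cd_domain b1 bm1 \<inter> cd_supp e n \<Longrightarrow> cd_image_exists u n g p \<zeta>"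
    and cases: "r = 2
      \<or> 3 \<le> r \<and> (\<forall>t\<in>Rn n. f t \<in> cd_reals \<and> g t \<in> cd_reals)
      \<or> 3 \<le> r \<and> \<alpha> \<in> cd_reals \<and> \<beta> \<in> cd_reals"
  shows "\<forall>p \<in> cd_domain a1 am1 \<inter> cd_domain b1 bm1 \<inter> cd_supp e n.
    cd_image_exists u n (\<lambda>t. \<alpha> \<odot> f t + \<beta> \<odot> g t) p \<zeta> \<and>
    cd_image u n (\<lambda>t. \<alpha> \<odot> f t + \<beta> \<odot> g t) p \<zeta>
      = \<alpha> \<odot> cd_image u n f p \<zeta> + \<beta> \<odot> cd_image u n g p \<zeta>"
proof -
  \<comment> \<open>The case distinction enters only here: the algebra is associative, or the middle
    factor is real, or the first factor is real. The last factor \<open>z\<close> stays arbitrary,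
    so the form of the kernel does not matter.\<close>
  have assoc: "(\<alpha> \<odot> f t) \<odot> z = \<alpha> \<odot> (f t \<odot> z)" "(\<beta> \<odot> g t) \<odot> z = \<beta> \<odot> (g t \<odot> z)"
    if "t \<in> Rn n" for t z
    using cases that r(1) by (auto intro: cd_times_assoc_quaternion cd_times_assoc_real)
  show ?thesis
    using image_f image_g assoc by (auto intro: cd_image_exists_lincomb cd_image_lincomb)
qed

end
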